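(* Let $\lambda:\lambda_1\ge\cdots\ge\lambda_n$ be a non-increasing sequence of real numbers and $\mu=(\mu_1,\ldots,\mu_n)$ an element of $\mathbb{R}^n$ that is majorized by $\lambda$. Then there is a unique GT pattern $\mathcal{P}:\lambda^1,\ldots,\lambda^n$ with bounding sequence $\lambda^n=\lambda$, weight $\mu$, and satisfying the following: for any $j$, $1\le j\le n$, its $j$-th row $\lambda^j$ majorizes the $j$-th row $\kappa^j$ of any GT pattern $\kappa^1,\ldots,\kappa^n$ with bounding sequence $\lambda$ and weight $\mu$. This unique pattern $\mathcal{P}$ has the following properties: (A) It is integral (all its entries are integers) if $\lambda$ and $\mu$ are integral. (B) Its area equals $\frac12(\|\lambda\|^2-\|\mu\|^2)$, which is strictly more than the area of any other GT pattern with bounding sequence $\lambda$ and weight $\mu$.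
   Context: For $x=(x_1,\ldots,x_n)\in\mathbb{R}^n$, $\|x\|^2=x_1^2+\cdots+x_n^2$, and $x^\downarrow=(x_1^\downarrow,\ldots,x_n^\downarrow)$ is the rearrangement of the coordinates of $x$ in non-increasing order. For $x,y\in\mathbb{R}^n$, $x$ majorizes $y$ if $x_1^\downarrow+\cdots+x_k^\downarrow\ge y_1^\downarrow+\cdots+y_k^\downarrow$ for all $1\le k\le n$ and $x_1+\cdots+x_n=y_1+\cdots+y_n$. Non-increasing real sequences $\lambda:\lambda_1\ge\cdots\ge\lambda_m$ and $\mu:\mu_1\ge\cdots\ge\mu_{m-1}$ interlace if $\lambda_i\ge\mu_i\ge\lambda_{i+1}$ for $1\le i\le m-1$. A Gelfand-Tsetlin (GT) pattern is a sequence $\lambda^1,\ldots,\lambda^n$ of non-increasing real sequences, with $\lambda^j$ of length $j$, such that $\lambda^j$ and $\lambda^{j+1}$ interlace for $1\le j\le n-1$. The sequence $\lambda^j$ is its $j$-th row; $\lambda^n$ is its bounding sequence. Its weight is $(a_1,\ldots,a_n)$, where $a_j$ is the sum of the entries of row $j$ minus the sum of the entries of row $j-1$ (row $0$ is empty, with sum $0$). The area of an interlacing pair $\lambda,\mu$ of lengths $m$ and $m-1$ is $\sum_{i=1}^{m-1}(\lambda_i-\mu_i)(\mu_i-\lambda_{i+1})$ (zero if $m=1$). The area of a pattern $\lambda^1,\ldots,\lambda^n$ is the sum over $j=1,\ldots,n$ of the areas of the pairs $\lambda^j,\lambda^{j-1}$. *)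

theory Defs
  imports Complex_Main
begin

text \<open>
  Finite real sequences \<open>x\<^sub>1, \<dots>, x\<^sub>n\<close> are lists of reals; the entry \<open>x\<^sub>i\<close> is \<open>x ! (i - 1)\<close>.
\<close>

definition norm_sq :: "real list \<Rightarrow> real" where
  "norm_sq x = (\<Sum>i<length x. (x ! i)\<^sup>2)"

definition non_increasing :: "real list \<Rightarrow> bool" where
  "non_increasing x \<longleftrightarrow> sorted_wrt (\<ge>) x"

definition dec_rearr :: "real list \<Rightarrow> real list" where
  "dec_rearr x = rev (sort x)"

definition majorizes :: "real list \<Rightarrow> real list \<Rightarrow> bool" where
  "majorizes x y \<longleftrightarrow>
     length x = length y \<and>
     (\<forall>k\<in>{1..length x}. sum_list (take k (dec_rearr x)) \<ge> sum_list (take k (dec_rearr y))) \<and>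
     sum_list x = sum_list y"

definition interlace :: "real list \<Rightarrow> real list \<Rightarrow> bool" where
  "interlace l m \<longleftrightarrow>
     non_increasing l \<and> non_increasing m \<and> length l = Suc (length m) \<and>
     (\<forall>i<length m. l ! i \<ge> m ! i \<and> m ! i \<ge> l ! Suc i)"

text \<open>
  A pattern is the list of its rows, \<open>[\<lambda>\<^sup>1, \<dots>, \<lambda>\<^sup>n]\<close>; rows are numbered from 1, and row 0 is empty.
\<close>

definition row :: "real list list \<Rightarrow> nat \<Rightarrow> real list" where
  "row P j = (if j = 0 then [] else P ! (j - 1))"

definition gt_pattern :: "nat \<Rightarrow> real list list \<Rightarrow> bool" where
  "gt_pattern n P \<longleftrightarrow>
     length P = n \<and>
     (\<forall>j\<in>{1..n}. length (row P j) = j \<and> non_increasing (row P j)) \<and>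
     (\<forall>j\<in>{1..<n}. interlace (row P (Suc j)) (row P j))"

definition weight :: "real list list \<Rightarrow> real list" where
  "weight P = map (\<lambda>j. sum_list (row P j) - sum_list (row P (j - 1))) [1..<Suc (length P)]"

definition gt_patterns :: "nat \<Rightarrow> real list \<Rightarrow> real list \<Rightarrow> real list list set" where
  "gt_patterns n l m = {P. gt_pattern n P \<and> row P n = l \<and> weight P = m}"

definition pair_area :: "real list \<Rightarrow> real list \<Rightarrow> real" where
  "pair_area l m = (\<Sum>i<length l - 1. (l ! i - m ! i) * (m ! i - l ! Suc i))"

definition area :: "real list list \<Rightarrow> real" where
  "area P = (\<Sum>j = 1..length P. pair_area (row P j) (row P (j - 1)))"

definition integral_seq :: "real list \<Rightarrow> bool" where
  "integral_seq x \<longleftrightarrow> set x \<subseteq> \<int>"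

definition integral_pattern :: "real list list \<Rightarrow> bool" where
  "integral_pattern P \<longleftrightarrow> (\<forall>r\<in>set P. integral_seq r)"

definition row_dominant :: "nat \<Rightarrow> real list \<Rightarrow> real list \<Rightarrow> real list list \<Rightarrow> bool" where
  "row_dominant n l m P \<longleftrightarrow>
     P \<in> gt_patterns n l m \<and>
     (\<forall>j\<in>{1..n}. \<forall>K\<in>gt_patterns n l m. majorizes (row P j) (row K j))"

end

theory Submission
  imports Defs "HOL-Library.Multiset"
begin

text \<open>
  Put \<open>d\<^sub>i = \<lambda>\<^sub>i - \<kappa>\<^sub>i\<close> and \<open>e\<^sub>i = \<kappa>\<^sub>i - \<lambda>\<^sub>i\<^sub>+\<^sub>1\<close> for an interlacing pair \<open>\<lambda>, \<kappa>\<close> with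
  \<open>a = \<Sum>\<lambda> - \<Sum>\<kappa>\<close>.  Then \<open>\<parallel>\<lambda>\<parallel>\<^sup>2 - \<parallel>\<kappa>\<parallel>\<^sup>2 - a\<^sup>2\<close> minus twice the area of the pair equals
  \<open>2 \<Sum>\<^sub>i\<^sub><\<^sub>j d\<^sub>i e\<^sub>j \<ge> 0\<close>, and this vanishes for exactly one \<open>\<kappa>\<close> with the given \<open>\<lambda>\<close> and \<open>a\<close>:
  if \<open>\<lambda>\<^sub>k \<ge> a \<ge> \<lambda>\<^sub>k\<^sub>+\<^sub>1\<close>, replace the two entries \<open>\<lambda>\<^sub>k, \<lambda>\<^sub>k\<^sub>+\<^sub>1\<close> by the single
  entry \<open>\<lambda>\<^sub>k + \<lambda>\<^sub>k\<^sub>+\<^sub>1 - a\<close>.  Telescoping over the rows gives the area statement.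
  The \<open>i\<close>-th partial sum of this \<open>\<kappa>\<close> is \<open>min (S\<^sub>i(\<lambda>)) (S\<^sub>i\<^sub>+\<^sub>1(\<lambda>) - a)\<close>.  This is
  monotone in \<open>\<lambda>\<close> and bounds the \<open>i\<close>-th partial sum of every interlacing row with the same sum,
  whence row dominance; it also bounds the sum of any \<open>i\<close> of the remaining weights, so the
  construction can be iterated.
\<close>

section \<open>Majorization and decreasing rearrangements\<close>

lemma dec_rearr_eqI:
  assumes "mset x = mset y" "non_increasing y"
  shows "dec_rearr x = y"
proof -
  have "sorted (rev y)"
    using assms(2) by (simp add: non_increasing_def sorted_wrt_rev)
  then have "sort x = rev y"
    using assms(1) by (intro properties_for_sort) simp_all
  then show ?thesis by (simp add: dec_rearr_def)
qed

lemma dec_rearr_id: "non_increasing x \<Longrightarrow> dec_rearr x = x"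
  by (rule dec_rearr_eqI) auto

lemma mset_dec_rearr [simp]: "mset (dec_rearr x) = mset x"
  by (simp add: dec_rearr_def)

lemma length_dec_rearr [simp]: "length (dec_rearr x) = length x"
  by (simp add: dec_rearr_def)

lemma non_increasing_dec_rearr: "non_increasing (dec_rearr x)"
  by (simp add: dec_rearr_def non_increasing_def sorted_wrt_rev)

lemma sum_list_dec_rearr: "sum_list (dec_rearr x) = sum_list x"
  by (simp add: dec_rearr_def flip: sum_mset_sum_list)

lemma majorizes_take:
  assumes "majorizes x y"
  shows "sum_list (take k (dec_rearr y)) \<le> sum_list (take k (dec_rearr x))"
proof -
  consider "k = 0" | "k \<in> {1..length x}" | "length x \<le> k" by fastforce
  then show ?thesis
    using assms by cases (auto simp: majorizes_def sum_list_dec_rearr)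
qed

text \<open>Equal partial sums determine the entries as their differences; sortedness identifies
  each list with its rearrangement.\<close>

lemma majorizes_antisym:
  assumes "majorizes x y" "majorizes y x" "non_increasing x" "non_increasing y"
  shows "x = y"
proof (rule nth_equalityI)
  show len: "length x = length y"
    using assms(1) by (simp add: majorizes_def)
  have eq: "sum_list (take k x) = sum_list (take k y)" for k
    using majorizes_take[OF assms(1), of k] majorizes_take[OF assms(2), of k]
    by (simp add: assms(3,4) dec_rearr_id)
  show "x ! i = y ! i" if "i < length x" for i
    using that len eq[of i] eq[of "Suc i"] by (simp add: take_Suc_conv_app_nth)
qed

text \<open>Any \<open>i\<close> entries of \<open>xs\<close> are also entries of
  \<open>xs @ [a]\<close>, and joining \<open>a\<close> to them gives \<open>Suc i\<close> such
  entries; neither sum exceeds that of the largest ones.\<close>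

lemma sum_take_dec_rearr_snoc:
  fixes xs :: "real list"
  assumes "i \<le> length xs"
  shows "sum_list (take i (dec_rearr xs)) \<le> sum_list (take i (dec_rearr (xs @ [a])))"
    and "sum_list (take i (dec_rearr xs)) \<le> sum_list (take (Suc i) (dec_rearr (xs @ [a]))) - a"
proof -
  define D where "D = dec_rearr (xs @ [a])"
  have mD: "mset D = add_mset a (mset xs)" by (simp add: D_def)
  then have "a \<in> set D" by (metis set_mset_mset union_single_eq_member)
  then obtain u v where D: "D = u @ a # v" by (meson split_list)
  have srt: "sorted_wrt (\<ge>) (u @ a # v)"
    using non_increasing_dec_rearr[of "xs @ [a]"] by (simp add: D_def[symmetric] D non_increasing_def)
  have d: "dec_rearr xs = u @ v"
    using mD srt by (intro dec_rearr_eqI) (auto simp: D non_increasing_def sorted_wrt_append)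
  have "length D = Suc (length xs)"
    by (simp add: D_def)
  then have i: "i < length D" using assms by simp
  have step: "sum_list (take (Suc i) D) = sum_list (take i D) + D ! i"
    using i by (simp add: take_Suc_conv_app_nth)
  have "sum_list (take i (u @ v)) \<le> sum_list (take i D) \<and>
    sum_list (take i (u @ v)) \<le> sum_list (take (Suc i) D) - a"
  \<comment> \<open>Either the first \<open>i\<close> entries of \<open>D\<close> precede the chosen
    occurrence of \<open>a\<close>, or the first \<open>Suc i\<close> include it.\<close>
  proof (cases "i \<le> length u")
    case True
    then have "a \<le> D ! i"
      using srt by (cases "i = length u") (auto simp: D nth_append sorted_wrt_append)
    then show ?thesis using True step by (simp add: D)
  next
    case False
    then have "D ! i \<in> set v" using i
      by (auto simp: D nth_append nth_Cons split: nat.splits)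
    then have "D ! i \<le> a" using srt by (auto simp: sorted_wrt_append)
    moreover have "sum_list (take (Suc i) D) = sum_list (take i (u @ v)) + a"
      using False by (simp add: D Suc_diff_le)
    ultimately show ?thesis using step by simp
  qed
  then show "sum_list (take i (dec_rearr xs)) \<le> sum_list (take i (dec_rearr (xs @ [a])))"
    and "sum_list (take i (dec_rearr xs)) \<le> sum_list (take (Suc i) (dec_rearr (xs @ [a]))) - a"
    by (simp_all add: d D_def)
qed

section \<open>Interlacing by recursion on the first entries\<close>

lemma norm_sq_simps [simp]:
  "norm_sq [] = 0" "norm_sq (x # xs) = x\<^sup>2 + norm_sq xs"
  by (simp_all add: norm_sq_def sum.lessThan_Suc_shift del: sum.lessThan_Suc)

lemma norm_sq_append: "norm_sq (xs @ ys) = norm_sq xs + norm_sq ys"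
  by (induction xs) auto

lemma pair_area_simps [simp]:
  "pair_area [x] m = 0"
  "pair_area (x # y # l) (z # m) = (x - z) * (z - y) + pair_area (y # l) m"
  by (simp_all add: pair_area_def sum.lessThan_Suc_shift del: sum.lessThan_Suc)

lemma interlace_Nil: "interlace l [] \<longleftrightarrow> (\<exists>x. l = [x])"
  by (auto simp: interlace_def non_increasing_def length_Suc_conv)

lemma interlace_Cons:
  "interlace (x # y # l) (z # m) \<longleftrightarrow> z \<le> x \<and> y \<le> z \<and> interlace (y # l) m"
proof
  assume *: "interlace (x # y # l) (z # m)"
  then have "m ! i \<le> (y # l) ! i \<and> l ! i \<le> m ! i" if "i < length m" for i
    using that unfolding interlace_def by (metis Suc_less_eq length_Cons nth_Cons_Suc)
  moreover have "z \<le> x \<and> y \<le> z"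
    using * unfolding interlace_def by (metis length_Cons nth_Cons_0 nth_Cons_Suc zero_less_Suc)
  ultimately show "z \<le> x \<and> y \<le> z \<and> interlace (y # l) m"
    using * by (auto simp: interlace_def non_increasing_def)
next
  assume *: "z \<le> x \<and> y \<le> z \<and> interlace (y # l) m"
  then have il: "interlace (y # l) m" by simp
  have l: "\<forall>t\<in>set l. t \<le> y"
    using il by (auto simp: interlace_def non_increasing_def)
  \<comment> \<open>Sortedness of \<open>z # m\<close> has to be recovered: each entry of
    \<open>m\<close> is below one of \<open>y # l\<close>, hence below
    \<open>y \<le> z\<close>.\<close>
  have "m ! i \<le> y" if "i < length m" for i
  proof -
    have "m ! i \<le> (y # l) ! i" "length l = length m" using il that by (auto simp: interlace_def)
    moreover from this have "(y # l) ! i \<in> set (y # l)" using that by (intro nth_mem) simp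
    then have "(y # l) ! i \<le> y" using l by auto
    ultimately show ?thesis by simp
  qed
  then have "\<forall>t\<in>set m. t \<le> y" by (auto simp: in_set_conv_nth)
  then show "interlace (x # y # l) (z # m)"
    using * l by (fastforce simp: interlace_def non_increasing_def nth_Cons split: nat.splits)
qed

lemma interlace_induct [consumes 1, case_names single Cons]:
  assumes "interlace l m"
    and "\<And>x. P [x] []"
    and "\<And>x y z l m. z \<le> x \<Longrightarrow> y \<le> z \<Longrightarrow> interlace (y # l) m \<Longrightarrow> P (y # l) m \<Longrightarrow> P (x # y # l) (z # m)"
  shows "P l m"
  using assms(1)
proof (induction m arbitrary: l)
  case Nil
  then show ?case using assms(2) by (auto simp: interlace_Nil)
next
  case (Cons z m)
  then obtain x y l' where "l = x # y # l'"
    by (auto simp: interlace_def length_Suc_conv)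
  with Cons show ?case using assms(3) by (auto simp: interlace_Cons)
qed

text \<open>Add up the upper bounds on the first \<open>i\<close> entries of \<open>m\<close>,
  respectively the lower bounds on the others. With \<open>a = sum_list l - sum_list m\<close>, the
  two results bound the \<open>i\<close>-th partial sum of \<open>m\<close> by both terms of the
  minimum in \<open>sum_take_merge_row\<close>.\<close>

lemma interlace_sum_take:
  assumes "interlace l m" "i < length l"
  shows "sum_list (take i m) \<le> sum_list (take i l)"
    and "sum_list l - sum_list (take (Suc i) l) \<le> sum_list m - sum_list (take i m)"
proof -
  have "sum_list (take i m) \<le> sum_list (take i l) \<and>
    sum_list l - sum_list (take (Suc i) l) \<le> sum_list m - sum_list (take i m)"
    using assms
  proof (induction arbitrary: i rule: interlace_induct)
    case (Cons x y z l m)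
    show ?case
    proof (cases i)
      case 0
      then show ?thesis using Cons.hyps Cons.IH[of 0] by simp
    next
      case (Suc j)
      then show ?thesis using Cons.hyps Cons.prems Cons.IH[of j] by simp
    qed
  qed simp
  then show "sum_list (take i m) \<le> sum_list (take i l)"
    and "sum_list l - sum_list (take (Suc i) l) \<le> sum_list m - sum_list (take i m)"
    by auto
qed

text \<open>\<open>tl l\<close> is the entrywise least row interlacing with \<open>l\<close>, so
  equal sums force equal entries.\<close>

lemma interlace_tl:
  assumes "interlace l m"
  shows "sum_list (tl l) \<le> sum_list m" and "sum_list m = sum_list (tl l) \<Longrightarrow> m = tl l"
proof -
  have "sum_list (tl l) \<le> sum_list m \<and> (sum_list m = sum_list (tl l) \<longrightarrow> m = tl l)"
    using assms by (induction rule: interlace_induct) force+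
  then show "sum_list (tl l) \<le> sum_list m" "sum_list m = sum_list (tl l) \<Longrightarrow> m = tl l"
    by auto
qed

section \<open>The extremal row below a given row\<close>

fun merge_row :: "real list \<Rightarrow> real \<Rightarrow> real list" where
  "merge_row (x # y # l) a = (if y \<le> a then (x + y - a) # l else x # merge_row (y # l) a)"
| "merge_row _ a = []"

lemma length_merge_row: "length (merge_row l a) = length l - 1"
  by (induction l a rule: merge_row.induct) auto

lemma interlace_tl_self: "non_increasing l \<Longrightarrow> l \<noteq> [] \<Longrightarrow> interlace l (tl l)"
proof (induction l rule: induct_list012)
  case (3 x y l)
  then show ?case by (auto simp: interlace_Cons non_increasing_def)
qed (auto simp: interlace_Nil)

lemma interlace_merge_row:
  "non_increasing l \<Longrightarrow> l \<noteq> [] \<Longrightarrow> a \<le> hd l \<Longrightarrow> interlace l (merge_row l a)"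
proof (induction l a rule: merge_row.induct)
  case (1 x y l a)
  then show ?case
    using interlace_tl_self[of "y # l"]
    by (auto simp: interlace_Cons non_increasing_def)
qed (auto simp: interlace_Nil)

text \<open>The bound \<open>last l \<le> a\<close> makes the scan find a pair to merge; without one
  the last entry would be dropped instead of \<open>a\<close>. A one-entry row must be
  \<open>[a]\<close>.\<close>

lemma sum_list_merge_row:
  "l \<noteq> [] \<Longrightarrow> last l \<le> a \<Longrightarrow> a \<le> hd l \<Longrightarrow> sum_list (merge_row l a) = sum_list l - a"
  by (induction l a rule: merge_row.induct) auto

text \<open>The two terms differ by \<open>l ! i - a\<close>, which is nonnegative up to the upper
  entry of the merged pair and at most 0 from its lower entry on.\<close>

lemma sum_take_merge_row:
  "non_increasing l \<Longrightarrow> a \<le> hd l \<Longrightarrow> Suc i < length l \<Longrightarrow>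
   sum_list (take i (merge_row l a)) = min (sum_list (take i l)) (sum_list (take (Suc i) l) - a)"
proof (induction l a arbitrary: i rule: merge_row.induct)
  case (1 x y l a)
  show ?case
  proof (cases i)
    case 0
    then show ?thesis using 1 by simp
  next
    case (Suc j)
    have j: "j < length l" using "1.prems" Suc by simp
    then have "(y # l) ! j \<in> set (y # l)" by (intro nth_mem) simp
    then have le: "(y # l) ! j \<le> y" using "1.prems"(1) by (auto simp: non_increasing_def)
    have "sum_list (take (Suc j) (y # l)) = sum_list (take j (y # l)) + (y # l) ! j"
      using j by (subst take_Suc_conv_app_nth) simp_all
    then have eq: "y + sum_list (take j l) = sum_list (take j (y # l)) + (y # l) ! j" by simp
    show ?thesis
    proof (cases "y \<le> a")
      case True
      then show ?thesis using le eq Suc by simp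
    next
      case False
      then show ?thesis using 1 j Suc by (simp add: non_increasing_def)
    qed
  qed
qed auto

lemma set_merge_row_Ints: "set l \<subseteq> \<int> \<Longrightarrow> a \<in> \<int> \<Longrightarrow> set (merge_row l a) \<subseteq> \<int>"
  by (induction l a rule: merge_row.induct) auto

section \<open>The area defect of an interlacing pair\<close>

definition area_defect :: "real list \<Rightarrow> real list \<Rightarrow> real" where
  "area_defect l m =
     norm_sq l - norm_sq m - (sum_list l - sum_list m)\<^sup>2 - 2 * pair_area l m"

text \<open>For an interlacing pair, \<open>x - z\<close> is the first \<open>d\<close> and
  \<open>sum_list m - sum_list l\<close> the sum of all later \<open>e\<close>: the double sum is
  unrolled by its first index.\<close>

lemma area_defect_simps [simp]:
  "area_defect [x] [] = 0"
  "area_defect (x # y # l) (z # m) =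
     area_defect (y # l) m + 2 * (x - z) * (sum_list m - sum_list l)"
  by (simp_all add: area_defect_def power2_eq_square algebra_simps)

lemma area_defect_nonneg: "interlace l m \<Longrightarrow> 0 \<le> area_defect l m"
proof (induction rule: interlace_induct)
  case (Cons x y z l m)
  then show ?case using interlace_tl(1)[OF Cons.hyps(3)] by simp
qed simp

lemma area_defect_tl: "l \<noteq> [] \<Longrightarrow> area_defect l (tl l) = 0"
  by (induction l rule: induct_list012) auto

text \<open>Every \<open>d\<close> before the merged pair and every \<open>e\<close> after it is 0,
  so no product of a \<open>d\<close> with a later \<open>e\<close> survives.\<close>

lemma area_defect_merge_row: "l \<noteq> [] \<Longrightarrow> area_defect l (merge_row l a) = 0"
  using area_defect_tl by (induction l a rule: merge_row.induct) fastforce+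

lemma area_defect_eq_0_imp:
  "interlace l m \<Longrightarrow> area_defect l m = 0 \<Longrightarrow> m = merge_row l (sum_list l - sum_list m)"
proof (induction rule: interlace_induct)
  case (Cons x y z l m)
  note tl = interlace_tl[OF Cons.hyps(3), simplified]
  have nn: "0 \<le> area_defect (y # l) m" "0 \<le> (x - z) * (sum_list m - sum_list l)"
    using Cons.hyps tl(1) area_defect_nonneg by simp_all
  have "area_defect (y # l) m + 2 * ((x - z) * (sum_list m - sum_list l)) = 0"
    using Cons.prems by (simp add: algebra_simps)
  with nn have "area_defect (y # l) m = 0" "(x - z) * (sum_list m - sum_list l) = 0"
    by linarith+
  then have 0: "area_defect (y # l) m = 0" "x = z \<or> sum_list m = sum_list l"
    by auto
  show ?case
  proof (cases "sum_list m = sum_list l")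
    case True
    \<comment> \<open>Here \<open>m = l\<close> and the removed weight is
      \<open>x + y - z \<ge> y\<close>, so the first pair merges, into \<open>z\<close>.\<close>
    then show ?thesis using tl(2) Cons.hyps by simp
  next
    case False
    then have "x = z" "sum_list l < sum_list m" using 0 tl(1) by auto
    \<comment> \<open>The removed weight is now below \<open>y\<close>, so the scan keeps
      \<open>x\<close> and moves on.\<close>
    then show ?thesis using Cons.IH 0 by simp
  qed
qed simp

section \<open>Adding a bounding row to a pattern\<close>

lemma row_append: "j \<le> length P \<Longrightarrow> row (P @ Q) j = row P j"
  by (auto simp: row_def nth_append)

lemma row_snoc: "row (P @ [l]) (Suc (length P)) = l"
  by (simp add: row_def)

lemma weight_snoc:
  "weight (P @ [l]) = weight P @ [sum_list l - sum_list (row P (length P))]"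
  by (auto simp: weight_def row_append row_snoc)

lemma area_snoc: "area (P @ [l]) = area P + pair_area l (row P (length P))"
proof -
  have "(\<Sum>j = 1..length P. pair_area (row (P @ [l]) j) (row (P @ [l]) (j - 1))) = area P"
    unfolding area_def by (intro sum.cong) (auto simp: row_append)
  then show ?thesis by (simp add: area_def row_append row_snoc)
qed

lemma gt_patterns_0: "P \<in> gt_patterns 0 l m \<longleftrightarrow> P = [] \<and> l = [] \<and> m = []"
  by (auto simp: gt_patterns_def gt_pattern_def row_def weight_def)

lemma gt_patterns_length: "P \<in> gt_patterns n l m \<Longrightarrow> length P = n"
  by (simp add: gt_patterns_def gt_pattern_def)

lemma gt_patterns_row: "P \<in> gt_patterns n l m \<Longrightarrow> row P n = l"
  by (simp add: gt_patterns_def)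

text \<open>The case \<open>n = 0\<close> is included: \<open>k\<close> is then the empty row 0, and
  \<open>interlace l []\<close> only says that \<open>l\<close> has one entry.\<close>

lemma gt_patterns_snoc:
  "P @ [l] \<in> gt_patterns (Suc n) l' (m @ [a]) \<longleftrightarrow>
     l' = l \<and> (\<exists>k. P \<in> gt_patterns n k m \<and> interlace l k \<and> length l = Suc n \<and> a = sum_list l - sum_list k)"
proof -
  have sets: "{1..Suc n} = insert (Suc n) {1..n}" "n \<noteq> 0 \<Longrightarrow> {1..<Suc n} = insert n {1..<n}"
    by auto
  have 0: "interlace l [] \<longleftrightarrow> length l = Suc 0 \<and> non_increasing l"
    by (auto simp: interlace_def non_increasing_def)
  show ?thesis
  proof (cases "length P = n")
    case True
    then have rows: "row (P @ [l]) (Suc n) = l" "\<And>j. j \<le> n \<Longrightarrow> row (P @ [l]) j = row P j"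
      by (auto simp: row_append row_snoc)
    then have lengths: "(\<forall>j\<in>{1..Suc n}. length (row (P @ [l]) j) = j \<and> non_increasing (row (P @ [l]) j)) \<longleftrightarrow>
        (\<forall>j\<in>{1..n}. length (row P j) = j \<and> non_increasing (row P j)) \<and>
        length l = Suc n \<and> non_increasing l"
      unfolding sets(1) by auto
    have "gt_pattern (Suc n) (P @ [l]) \<longleftrightarrow>
      gt_pattern n P \<and> length l = Suc n \<and> interlace l (row P n)"
    proof (cases "n = 0")
      case True
      then show ?thesis
        unfolding gt_pattern_def lengths using \<open>length P = n\<close> by (auto simp: 0 row_def)
    next
      case False
      have "(\<forall>j\<in>{1..<Suc n}. interlace (row (P @ [l]) (Suc j)) (row (P @ [l]) j)) \<longleftrightarrow>
          interlace l (row P n) \<and> (\<forall>j\<in>{1..<n}. interlace (row P (Suc j)) (row P j))"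
        unfolding sets(2)[OF False] using rows by auto
      then show ?thesis
        unfolding gt_pattern_def lengths using \<open>length P = n\<close> by (auto simp: interlace_def)
    qed
    note * = this
    show ?thesis
      using True by (auto simp: gt_patterns_def * rows weight_snoc)
  qed (auto simp: gt_patterns_def gt_pattern_def)
qed

lemma gt_patterns_SucE:
  assumes "P \<in> gt_patterns (Suc n) l (m @ [a])"
  obtains P' k where "P = P' @ [l]" "P' \<in> gt_patterns n k m" "interlace l k"
    "length l = Suc n" "a = sum_list l - sum_list k"
proof -
  obtain P' l' where P: "P = P' @ [l']"
    using gt_patterns_length[OF assms] by (metis length_Suc_conv_rev)
  with assms show ?thesis using that by (auto simp: gt_patterns_snoc)
qed

text \<open>The weight is consumed from its last entry, so it is passed in reverse.\<close>

fun max_pattern :: "real list \<Rightarrow> real list \<Rightarrow> real list list" where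
  "max_pattern l [] = []"
| "max_pattern l (a # m) = max_pattern (merge_row l a) m @ [l]"

section \<open>Feasibility and dominance of the extremal pattern\<close>

lemma majorizes_last_bounds:
  assumes "majorizes l (m @ [a])" "non_increasing l"
  shows "last l \<le> a" "a \<le> hd l"
proof -
  have len: "length l = Suc (length m)" and sum: "sum_list l = sum_list m + a"
    using assms(1) by (auto simp: majorizes_def)
  then have l: "l \<noteq> []" by auto
  have "sum_list m \<le> sum_list (take (length m) (dec_rearr (m @ [a])))"
    using sum_take_dec_rearr_snoc(1)[of "length m" m a] by (simp add: sum_list_dec_rearr)
  also have "\<dots> \<le> sum_list (butlast l)"
    using majorizes_take[OF assms(1), of "length m"] assms(2) len
    by (simp add: dec_rearr_id butlast_conv_take)
  also have "\<dots> = sum_list l - last l"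
    using l by (cases l rule: rev_cases) auto
  finally show "last l \<le> a" using sum by simp
  have "a \<le> sum_list (take 1 (dec_rearr (m @ [a])))"
    using sum_take_dec_rearr_snoc(2)[of 0 m a] by simp
  also have "\<dots> \<le> sum_list (take 1 l)"
    using majorizes_take[OF assms(1), of 1] assms(2) by (simp add: dec_rearr_id)
  also have "\<dots> = hd l" using l by (cases l) auto
  finally show "a \<le> hd l" .
qed

text \<open>By \<open>sum_take_merge_row\<close>, majorization reduces to the two bounds
  \<open>bd\<close>. It is applied with \<open>y\<close> the remaining weight and with
  \<open>y\<close> a row of a competing pattern.\<close>

lemma majorizes_merge_row:
  assumes maj: "majorizes l (m @ [a])" and l: "non_increasing l"
    and len: "length y = length m" and sum: "sum_list y = sum_list l - a"
    and bd: "\<And>i. i < length m \<Longrightarrow> sum_list (take i (dec_rearr y)) \<le> sum_list (take i l)"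
      "\<And>i. i < length m \<Longrightarrow> sum_list (take i (dec_rearr y)) \<le> sum_list (take (Suc i) l) - a"
  shows "majorizes (merge_row l a) y"
proof -
  have len': "length l = Suc (length m)" using maj by (simp add: majorizes_def)
  note a = majorizes_last_bounds[OF maj l]
  have "l \<noteq> []" using len' by auto
  then have il: "interlace l (merge_row l a)" and s: "sum_list (merge_row l a) = sum_list l - a"
    using interlace_merge_row l a sum_list_merge_row by auto
  have "dec_rearr (merge_row l a) = merge_row l a"
    using il by (simp add: interlace_def dec_rearr_id)
  moreover have "sum_list (take k (merge_row l a)) \<ge> sum_list (take k (dec_rearr y))"
    if "k \<le> length m" for k
  proof (cases "k = length m")
    \<comment> \<open>The full sum lies outside the range of \<open>sum_take_merge_row\<close>; the
      totals agree.\<close>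
    case True
    then show ?thesis using s sum len len' by (simp add: length_merge_row sum_list_dec_rearr)
  next
    case False
    then show ?thesis using that bd[of k] l a len' by (simp add: sum_take_merge_row)
  qed
  ultimately show ?thesis
    using s sum len len' by (simp add: majorizes_def length_merge_row)
qed

lemma majorizes_merge_row_weight:
  assumes "majorizes l (m @ [a])" "non_increasing l"
  shows "majorizes (merge_row l a) m"
proof (rule majorizes_merge_row[OF assms])
  show "sum_list m = sum_list l - a" using assms(1) by (simp add: majorizes_def)
next
  fix i assume "i < length m"
  then show "sum_list (take i (dec_rearr m)) \<le> sum_list (take i l)"
    and "sum_list (take i (dec_rearr m)) \<le> sum_list (take (Suc i) l) - a"
    using sum_take_dec_rearr_snoc[of i m a] majorizes_take[OF assms(1), of i]
      majorizes_take[OF assms(1), of "Suc i"] assms(2) by (simp_all add: dec_rearr_id)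
qed simp

lemma majorizes_merge_row_interlace:
  assumes "majorizes l (m @ [a])" "non_increasing l" and maj: "majorizes l l'"
    and il: "interlace l' k" and a: "a = sum_list l' - sum_list k"
  shows "majorizes (merge_row l a) k"
proof (rule majorizes_merge_row[OF assms(1,2)])
  have k: "dec_rearr k = k" "dec_rearr l' = l'"
    using il by (auto simp: interlace_def dec_rearr_id)
  show "length k = length m"
    using assms by (simp add: majorizes_def interlace_def)
  show "sum_list k = sum_list l - a" using maj a by (simp add: majorizes_def)
  fix i assume "i < length m"
  then have "i < length l'" using assms(1) maj by (simp add: majorizes_def)
  then show "sum_list (take i (dec_rearr k)) \<le> sum_list (take i l)"
    and "sum_list (take i (dec_rearr k)) \<le> sum_list (take (Suc i) l) - a"
    using interlace_sum_take[OF il, of i] majorizes_take[OF maj, of i]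
      majorizes_take[OF maj, of "Suc i"] assms(2) a by (simp_all add: dec_rearr_id k)
qed

lemma interlace_merge_row_majorizes:
  assumes "majorizes l (m @ [a])" "non_increasing l"
  shows "interlace l (merge_row l a)" "sum_list (merge_row l a) = sum_list l - a"
proof -
  have "l \<noteq> []" using assms(1) by (auto simp: majorizes_def)
  then show "interlace l (merge_row l a)" "sum_list (merge_row l a) = sum_list l - a"
    using assms majorizes_last_bounds by (auto intro: interlace_merge_row sum_list_merge_row)
qed

lemma max_pattern_in_gt_patterns:
  "majorizes l m \<Longrightarrow> non_increasing l \<Longrightarrow> max_pattern l (rev m) \<in> gt_patterns (length m) l m"
proof (induction m arbitrary: l rule: rev_induct)
  case Nil
  then show ?case by (simp add: gt_patterns_0 majorizes_def)
next
  case (snoc a m)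
  note k = interlace_merge_row_majorizes[OF snoc.prems]
  have "max_pattern (merge_row l a) (rev m) \<in> gt_patterns (length m) (merge_row l a) m"
    using k majorizes_merge_row_weight[OF snoc.prems] by (intro snoc.IH) (auto simp: interlace_def)
  then have "max_pattern (merge_row l a) (rev m) @ [l] \<in> gt_patterns (Suc (length m)) l (m @ [a])"
    using snoc.prems k by (auto simp: gt_patterns_snoc majorizes_def intro!: exI[of _ "merge_row l a"])
  then show ?case by simp
qed

text \<open>The competitor \<open>Q\<close> may have any top row \<open>l'\<close> majorized by
  \<open>l\<close>, because after one step down the two patterns no longer share a bounding
  row.\<close>

lemma max_pattern_majorizes:
  "majorizes l m \<Longrightarrow> non_increasing l \<Longrightarrow> majorizes l l' \<Longrightarrow> Q \<in> gt_patterns (length m) l' m \<Longrightarrow>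
   1 \<le> j \<Longrightarrow> j \<le> length m \<Longrightarrow> majorizes (row (max_pattern l (rev m)) j) (row Q j)"
proof (induction m arbitrary: l l' Q rule: rev_induct)
  case (snoc a m)
  let ?P = "max_pattern (merge_row l a) (rev m)"
  note k = interlace_merge_row_majorizes[OF snoc.prems(1,2)]
  have maj: "majorizes (merge_row l a) m" and ni: "non_increasing (merge_row l a)"
    using k majorizes_merge_row_weight[OF snoc.prems(1,2)] by (auto simp: interlace_def)
  have lenP: "length ?P = length m"
    using max_pattern_in_gt_patterns[OF maj ni] by (rule gt_patterns_length)
  have "Q \<in> gt_patterns (Suc (length m)) l' (m @ [a])" using snoc.prems(4) by simp
  then obtain Q' k' where Q: "Q = Q' @ [l']" "Q' \<in> gt_patterns (length m) k' m" "interlace l' k'"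
    "a = sum_list l' - sum_list k'"
    by (rule gt_patterns_SucE)
  have lenQ: "length Q' = length m" using Q(2) by (rule gt_patterns_length)
  show ?case
  proof (cases "j \<le> length m")
    case True
    have "majorizes (merge_row l a) k'"
      using snoc.prems Q by (intro majorizes_merge_row_interlace)
    then have "majorizes (row ?P j) (row Q' j)"
      using snoc.IH[OF maj ni _ Q(2)] snoc.prems(5) True by blast
    then show ?thesis using True lenP lenQ by (simp add: Q(1) row_append)
  next
    case False
    then have "j = Suc (length m)" using snoc.prems by simp
    then show ?thesis using snoc.prems(3) row_snoc[of ?P l] row_snoc[of Q' l']
      by (simp add: Q(1) lenP lenQ)
  qed
qed simp

section \<open>Area, integrality and uniqueness\<close>

lemma area_max_pattern:
  "majorizes l m \<Longrightarrow> non_increasing l \<Longrightarrow>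
   2 * area (max_pattern l (rev m)) = norm_sq l - norm_sq m"
proof (induction m arbitrary: l rule: rev_induct)
  case Nil
  then show ?case by (simp add: majorizes_def area_def)
next
  case (snoc a m)
  let ?k = "merge_row l a"
  note k = interlace_merge_row_majorizes[OF snoc.prems]
  have maj: "majorizes ?k m" and ni: "non_increasing ?k"
    using k majorizes_merge_row_weight[OF snoc.prems] by (auto simp: interlace_def)
  have "max_pattern ?k (rev m) \<in> gt_patterns (length m) ?k m"
    using max_pattern_in_gt_patterns[OF maj ni] .
  then have "area (max_pattern ?k (rev m) @ [l]) = area (max_pattern ?k (rev m)) + pair_area l ?k"
    by (simp add: area_snoc gt_patterns_length gt_patterns_row)
  moreover have "area_defect l ?k = 0"
    using snoc.prems by (intro area_defect_merge_row) (auto simp: majorizes_def)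
  ultimately show ?case using snoc.IH[OF maj ni] k(2)
    by (simp add: area_defect_def norm_sq_append)
qed

text \<open>Summing the nonnegative defects telescopes the norms of the rows. Equality makes every
  defect 0, so each row is the \<open>merge_row\<close> of the one above.\<close>

lemma area_le:
  "Q \<in> gt_patterns (length m) l m \<Longrightarrow>
   2 * area Q \<le> norm_sq l - norm_sq m \<and>
   (2 * area Q = norm_sq l - norm_sq m \<longrightarrow> Q = max_pattern l (rev m))"
proof (induction m arbitrary: l Q rule: rev_induct)
  case Nil
  then show ?case by (simp add: gt_patterns_0 area_def)
next
  case (snoc a m)
  have "Q \<in> gt_patterns (Suc (length m)) l (m @ [a])" using snoc.prems by simp
  then obtain Q' k where Q: "Q = Q' @ [l]" "Q' \<in> gt_patterns (length m) k m" "interlace l k"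
    and a: "a = sum_list l - sum_list k"
    by (rule gt_patterns_SucE)
  have ar: "area Q = area Q' + pair_area l k"
    using Q(1,2) by (simp add: area_snoc gt_patterns_length gt_patterns_row)
  have G: "2 * pair_area l k = norm_sq l - norm_sq k - a\<^sup>2 - area_defect l k"
    by (simp add: area_defect_def a)
  have nn: "0 \<le> area_defect l k" using Q(3) by (rule area_defect_nonneg)
  note IH = snoc.IH[OF Q(2)]
  have "2 * area Q \<le> norm_sq l - norm_sq (m @ [a])"
    using IH ar G nn by (simp add: norm_sq_append)
  moreover have "Q = max_pattern l (rev (m @ [a]))" if "2 * area Q = norm_sq l - norm_sq (m @ [a])"
  proof -
    have "area_defect l k = 0" "2 * area Q' = norm_sq k - norm_sq m"
      using that IH ar G nn by (auto simp: norm_sq_append)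
    then show ?thesis
      using IH area_defect_eq_0_imp[OF Q(3)] by (simp add: Q(1) a)
  qed
  ultimately show ?case by blast
qed

lemma integral_max_pattern:
  "integral_seq l \<Longrightarrow> integral_seq m \<Longrightarrow> integral_pattern (max_pattern l m)"
proof (induction m arbitrary: l)
  case Nil
  then show ?case by (simp add: integral_pattern_def)
next
  case (Cons a m)
  then have "integral_pattern (max_pattern (merge_row l a) m)"
    by (intro Cons.IH) (simp_all add: integral_seq_def set_merge_row_Ints)
  then show ?case using Cons.prems by (auto simp: integral_pattern_def)
qed

lemma row_dominant_unique:
  assumes "row_dominant n l m P" "row_dominant n l m Q"
  shows "P = Q"
proof (rule nth_equalityI)
  have mem: "P \<in> gt_patterns n l m" "Q \<in> gt_patterns n l m"
    using assms by (auto simp: row_dominant_def)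
  then have len: "length P = n" "length Q = n" by (auto dest: gt_patterns_length)
  then show "length P = length Q" by simp
  fix i assume "i < length P"
  then have j: "Suc i \<in> {1..n}" using len by auto
  have "row P (Suc i) = row Q (Suc i)"
  proof (rule majorizes_antisym)
    show "majorizes (row P (Suc i)) (row Q (Suc i))" "majorizes (row Q (Suc i)) (row P (Suc i))"
      using assms mem j by (auto simp: row_dominant_def)
    show "non_increasing (row P (Suc i))" "non_increasing (row Q (Suc i))"
      using mem j by (auto simp: gt_patterns_def gt_pattern_def)
  qed
  then show "P ! i = Q ! i" by (simp add: row_def)
qed

theorem theorem3p2:
  fixes n :: nat and l m :: "real list"
  assumes "n \<ge> 1"
    and "length l = n" and "non_increasing l"
    and "length m = n" and "majorizes l m"
  shows "(\<exists>!P. row_dominant n l m P) \<and>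
    (\<forall>P. row_dominant n l m P \<longrightarrow>
       (integral_seq l \<and> integral_seq m \<longrightarrow> integral_pattern P) \<and>
       area P = (norm_sq l - norm_sq m) / 2 \<and>
       (\<forall>Q\<in>gt_patterns n l m. Q \<noteq> P \<longrightarrow> area Q < area P))"
proof -
  let ?P = "max_pattern l (rev m)"
  \<comment> \<open>Competitors in the theorem have top row \<open>l\<close> itself, the case
    \<open>l' = l\<close> of \<open>max_pattern_majorizes\<close>.\<close>
  have "majorizes l l" by (simp add: majorizes_def)
  then have dom: "row_dominant n l m ?P"
    unfolding row_dominant_def
    using max_pattern_in_gt_patterns[OF assms(5,3)] max_pattern_majorizes[OF assms(5,3)] assms(4)
    by auto
  have int: "integral_seq l \<Longrightarrow> integral_seq m \<Longrightarrow> integral_pattern ?P"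
    by (rule integral_max_pattern) (auto simp: integral_seq_def)
  have area: "2 * area ?P = norm_sq l - norm_sq m"
    using assms by (intro area_max_pattern)
  have less: "area Q < area ?P" if "Q \<in> gt_patterns n l m" "Q \<noteq> ?P" for Q
    using area_le[of Q m l] area that assms(4) by auto
  have "row_dominant n l m P \<longleftrightarrow> P = ?P" for P
    using row_dominant_unique dom by blast
  then show ?thesis using int area less by simp
qed

end
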